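(* For continuous maps $f:Z\to Y$ and $g:X\to Y$ between topological spaces, we have \[\max\{\mathrm{TC}(f)/\mathrm{sec}(g),\ \mathrm{sec}_{g}(f)\}\leq\mathrm{TC}_g(f)\leq\min\{\mathrm{TC}(f),\ \mathrm{sec}_{g}(f)\cdot\mathrm{TC}(Z)\}.\]
   Context: Maps are continuous. The sectional number $\mathrm{sec}(f)$ of a map $f:A\to B$ is the minimal cardinality of open covers of $B$ such that for each element $U$ of the cover there is a map $s:U\to A$ with $f\circ s$ equal to the inclusion $U\hookrightarrow B$ (with value $\infty$ if no finite such cover exists). For maps $p:E\to B$ and $g:X\to B$, the relative sectional number is $\mathrm{sec}_g(p)=\mathrm{sec}(g^\ast(p))$, where $g^\ast(p):X\times_B E\to X$, $(x,e)\mapsto x$, is the canonical pullback, $X\times_B E=\{(x,e)\in X\times E: g(x)=p(e)\}$. Equivalently, it is the minimal cardinality of open covers $\{U_i\}_{1\le i\le n}$ of $X$ such that for each $i$ there is a map $\sigma_i:U_i\to E$ with $p\circ\sigma_i=g_{|U_i}$. For a space $Z$, $Z^{[0,1]}$ is the space of paths $[0,1]\to Z$ with the compact-open topology, and $e_2^Z:Z^{[0,1]}\to Z\times Z$ is $e_2^Z(\gamma)=(\gamma(0),\gamma(1))$. For a map $f:Z\to Y$, $e_f:Z^{[0,1]}\to Z\times Y$ is $e_f=(1_Z\times f)\circ e_2^Z$. The topological complexity of $f$ is $\mathrm{TC}(f)=\mathrm{sec}(e_f)$; the topological complexity of $Z$ is $\mathrm{TC}(Z)=\mathrm{TC}(1_Z)=\mathrm{sec}(e_2^Z)$.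 For maps $f:Z\to Y$ and $g:X\to Y$, the topological complexity of $f$ relative to $g$ is $\mathrm{TC}_g(f)=\mathrm{sec}_{1_Z\times g}(e_f)$, where $1_Z\times g:Z\times X\to Z\times Y$.
   Formalization: The case Z empty with X nonempty is excluded, since there sec_g(f) is infinite while TC_g(f) is finite; the quotient TC(f)/sec(g) is read as 0 when sec(g) is infinite (also for infinity/infinity). *)

theory Defs
  imports "HOL-Analysis.Analysis"
begin

text \<open>
  Sectional number of a map \<open>f\<close> from \<open>A\<close> to \<open>B\<close>. The infimum of the empty set in \<^typ>\<open>enat\<close> is
  \<open>\<infinity>\<close>, which is the value when no finite cover exists. For empty \<open>B\<close> the empty family is
  a cover, so the value is then \<open>0\<close>.
\<close>

definition sectional_number :: "'a topology \<Rightarrow> 'b topology \<Rightarrow> ('a \<Rightarrow> 'b) \<Rightarrow> enat" where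
  "sectional_number A B f =
    (INF \<U> \<in> {\<U>. finite \<U> \<and> \<Union>\<U> = topspace B \<and>
        (\<forall>U\<in>\<U>. openin B U \<and>
           (\<exists>s. continuous_map (subtopology B U) A s \<and> (\<forall>b\<in>U. f (s b) = b)))}.
      enat (card \<U>))"

definition fibre_product ::
  "'x topology \<Rightarrow> 'e topology \<Rightarrow> ('x \<Rightarrow> 'b) \<Rightarrow> ('e \<Rightarrow> 'b) \<Rightarrow> ('x \<times> 'e) topology" where
  "fibre_product X E g p = subtopology (prod_topology X E) {(x, e). g x = p e}"

text \<open>
  \<open>relative_sectional_number E X p g\<close> is the sectional number of \<open>p : E \<rightarrow> B\<close> relative to
  \<open>g : X \<rightarrow> B\<close>. The topology of the common codomain \<open>B\<close> does not enter the construction.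
\<close>

definition relative_sectional_number ::
  "'e topology \<Rightarrow> 'x topology \<Rightarrow> ('e \<Rightarrow> 'b) \<Rightarrow> ('x \<Rightarrow> 'b) \<Rightarrow> enat" where
  "relative_sectional_number E X p g = sectional_number (fibre_product X E g p) X fst"

text \<open>
  Paths are functions on \<^typ>\<open>real\<close>; extensionality fixes their values outside the unit
  interval, so that each path is represented exactly once.
\<close>

definition paths :: "'a topology \<Rightarrow> (real \<Rightarrow> 'a) set" where
  "paths Z = {\<gamma>. pathin Z \<gamma> \<and> \<gamma> \<in> extensional {0..1}}"

text \<open>The path space carries the compact-open topology, given by its standard subbasis.\<close>

definition path_space :: "'a topology \<Rightarrow> (real \<Rightarrow> 'a) topology" where
  "path_space Z = topology_generated_by
    {{\<gamma> \<in> paths Z. \<gamma> ` K \<subseteq> U} | K U. compact K \<and> K \<subseteq> {0..1} \<and> openin Z U}"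

lemma topspace_path_space: "topspace (path_space Z) = paths Z"
proof -
  have "\<exists>K U. paths Z = {\<gamma> \<in> paths Z. \<gamma> ` K \<subseteq> U} \<and>
      compact K \<and> K \<subseteq> {0..1} \<and> openin Z U"
    by (rule exI[of _ "{}"], rule exI[of _ "{}"]) simp
  then show ?thesis
    unfolding path_space_def topology_generated_by_topspace by blast
qed

definition endpoints :: "(real \<Rightarrow> 'a) \<Rightarrow> 'a \<times> 'a" where
  "endpoints \<gamma> = (\<gamma> 0, \<gamma> 1)"

definition endpoint_map :: "('z \<Rightarrow> 'y) \<Rightarrow> (real \<Rightarrow> 'z) \<Rightarrow> 'z \<times> 'y" where
  "endpoint_map f = map_prod id f \<circ> endpoints"

definition TC_map :: "'z topology \<Rightarrow> 'y topology \<Rightarrow> ('z \<Rightarrow> 'y) \<Rightarrow> enat" where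
  "TC_map Z Y f = sectional_number (path_space Z) (prod_topology Z Y) (endpoint_map f)"

definition TC_space :: "'z topology \<Rightarrow> enat" where
  "TC_space Z = TC_map Z Z id"

text \<open>
  \<open>TC_relative Z X f g\<close> is the topological complexity of \<open>f : Z \<rightarrow> Y\<close> relative to \<open>g : X \<rightarrow> Y\<close>.
\<close>

definition TC_relative ::
  "'z topology \<Rightarrow> 'x topology \<Rightarrow> ('z \<Rightarrow> 'y) \<Rightarrow> ('x \<Rightarrow> 'y) \<Rightarrow> enat" where
  "TC_relative Z X f g =
    relative_sectional_number (path_space Z) (prod_topology Z X) (endpoint_map f) (map_prod id g)"

end

theory Submission
  imports Defs
begin

text \<open>
  All the numbers involved count open sets over which a map lifts along \<open>e_f\<close>, \<open>f\<close> or \<open>g\<close>.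
  Such lifts pull back along continuous maps; this gives \<open>TC_g(f) \<le> TC(f)\<close> and \<open>TC_f(f) \<le> TC(Z)\<close>
  and, restricting to a slice \<open>{z} \<times> X\<close> and evaluating paths at their end, \<open>sec_g(f) \<le> TC_g(f)\<close>.
  A local lift \<open>t\<close> of \<open>X\<close> to \<open>W\<close> yields the local map \<open>(z, x) \<mapsto> (z, t x)\<close> from \<open>Z \<times> X\<close> to
  \<open>Z \<times> W\<close>, along which lifts pull back as well. Intersecting the two kinds of open sets bounds a
  relative sectional number over \<open>Z \<times> X\<close> by a product, which covers both
  \<open>TC(f) \<le> sec(g) \<cdot> TC_g(f)\<close> and \<open>TC_g(f) \<le> sec_g(f) \<cdot> TC_f(f)\<close>.
\<close>

section \<open>Local lifts and the covers they form\<close>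

text \<open>For \<open>g = id\<close> the lifts are local sections of \<open>p\<close>, so plain and
  relative sectional numbers become instances of one notion.\<close>

definition liftable ::
  "'e topology \<Rightarrow> 'x topology \<Rightarrow> ('e \<Rightarrow> 'b) \<Rightarrow> ('x \<Rightarrow> 'b) \<Rightarrow> 'x set \<Rightarrow> bool" where
  "liftable E X p g U \<longleftrightarrow> openin X U \<and>
    (\<exists>\<sigma>. continuous_map (subtopology X U) E \<sigma> \<and> (\<forall>x\<in>U. p (\<sigma> x) = g x))"

definition liftable_covers ::
  "'e topology \<Rightarrow> 'x topology \<Rightarrow> ('e \<Rightarrow> 'b) \<Rightarrow> ('x \<Rightarrow> 'b) \<Rightarrow> 'x set set set" where
  "liftable_covers E X p g =
    {\<U>. finite \<U> \<and> \<Union>\<U> = topspace X \<and> (\<forall>U\<in>\<U>. liftable E X p g U)}"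

text \<open>Universal property of the pullback: a section over \<open>U\<close> is the graph
  \<open>x \<mapsto> (x, \<sigma> x)\<close> of a lift, and its second component recovers that
  lift.\<close>

lemma liftable_fibre_product:
  "liftable (fibre_product X E g p) X fst id U \<longleftrightarrow> liftable E X p g U" (is "?L \<longleftrightarrow> ?R")
proof
  assume ?L
  then obtain s where U: "openin X U"
    and s: "continuous_map (subtopology X U) (fibre_product X E g p) s"
    and fst_s: "\<And>x. x \<in> U \<Longrightarrow> fst (s x) = x"
    unfolding liftable_def by auto
  have "continuous_map (subtopology X U) E (snd \<circ> s)"
    using s unfolding fibre_product_def continuous_map_in_subtopology continuous_map_pairwise
    by blast
  moreover have "p (snd (s x)) = g x" if "x \<in> U" for x
  proof -
    have "x \<in> topspace (subtopology X U)"
      using that openin_subset[OF U] by auto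
    then have "s x \<in> {(x, e). g x = p e}"
      using s by (simp add: fibre_product_def continuous_map_in_subtopology Pi_iff)
    then show ?thesis
      using fst_s[OF that] by (auto simp: case_prod_beta)
  qed
  ultimately show ?R
    unfolding liftable_def using U by fastforce
next
  assume ?R
  then obtain \<sigma> where U: "openin X U"
    and \<sigma>: "continuous_map (subtopology X U) E \<sigma>" "\<And>x. x \<in> U \<Longrightarrow> p (\<sigma> x) = g x"
    unfolding liftable_def by auto
  have "continuous_map (subtopology X U) (fibre_product X E g p) (\<lambda>x. (x, \<sigma> x))"
    unfolding fibre_product_def continuous_map_in_subtopology continuous_map_pairwise
    using \<sigma> by (auto simp: o_def continuous_map_from_subtopology)
  then show ?L
    unfolding liftable_def using U by fastforce
qed

lemma sectional_number_eq:
  "sectional_number A B f = (INF \<U> \<in> liftable_covers A B f id. enat (card \<U>))"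
  unfolding sectional_number_def liftable_covers_def liftable_def by simp

lemma relative_sectional_number_eq:
  "relative_sectional_number E X p g = (INF \<U> \<in> liftable_covers E X p g. enat (card \<U>))"
  unfolding relative_sectional_number_def sectional_number_eq liftable_covers_def
    liftable_fibre_product ..

lemma sectional_number_eq_relative:
  "sectional_number A B f = relative_sectional_number A B f id"
  unfolding sectional_number_eq relative_sectional_number_eq ..

lemma relative_sectional_number_le:
  assumes "\<U> \<in> liftable_covers E X p g"
  shows "relative_sectional_number E X p g \<le> enat (card \<U>)"
  unfolding relative_sectional_number_eq using assms by (rule INF_lower)

lemma relative_sectional_number_attained:
  assumes "relative_sectional_number E X p g \<noteq> \<infinity>"
  obtains \<U> where "\<U> \<in> liftable_covers E X p g"
    and "relative_sectional_number E X p g = enat (card \<U>)"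
proof -
  let ?C = "(\<lambda>\<U>. enat (card \<U>)) ` liftable_covers E X p g"
  \<comment> \<open>The infimum of the empty set would be \<open>\<infinity>\<close>; a nonempty
    infimum in the well-order \<open>enat\<close> is attained.\<close>
  have "?C \<noteq> {}"
    using assms unfolding relative_sectional_number_eq by (auto simp: top_enat_def)
  then have "Inf ?C \<in> ?C"
    by (metis ex_in_conv wellorder_InfI)
  then show thesis
    using that unfolding relative_sectional_number_eq by blast
qed

text \<open>Only the empty space is covered by the empty family. This settles the cases where a
  product has the form \<open>0 * \<infinity>\<close>.\<close>

lemma relative_sectional_number_eq_0_iff:
  "relative_sectional_number E X p g = 0 \<longleftrightarrow> topspace X = {}"
proof
  assume 0: "relative_sectional_number E X p g = 0"
  then obtain \<U> where \<U>: "\<U> \<in> liftable_covers E X p g"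
    and "relative_sectional_number E X p g = enat (card \<U>)"
    using relative_sectional_number_attained[of E X p g] by auto
  then have "card \<U> = 0"
    using 0 by (simp add: zero_enat_def)
  then show "topspace X = {}"
    using \<U> unfolding liftable_covers_def by auto
next
  assume "topspace X = {}"
  then have "{} \<in> liftable_covers E X p g"
    unfolding liftable_covers_def by auto
  from relative_sectional_number_le[OF this] show "relative_sectional_number E X p g = 0"
    by (simp flip: zero_enat_def)
qed

section \<open>Transfer of lifts: pullback and product bound\<close>

text \<open>A lift \<open>\<sigma>\<close> over \<open>W\<close> gives
  \<open>k \<circ> \<sigma> \<circ> h\<close> over the preimage of \<open>W\<close>. The map
  \<open>h\<close> lives on an open \<open>A\<close> only, so that maps built from local lifts are
  covered.\<close>

lemma liftable_pullback:
  assumes A: "openin X A"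
    and h: "continuous_map (subtopology X A) X' h"
    and k: "continuous_map E' E k"
    and W: "liftable E' X' p' g' W"
    and compat: "\<And>x e. \<lbrakk>x \<in> A; p' e = g' (h x)\<rbrakk> \<Longrightarrow> p (k e) = g x"
  shows "liftable E X p g {x \<in> A. h x \<in> W}"
proof -
  obtain \<sigma> where W': "openin X' W"
    and \<sigma>: "continuous_map (subtopology X' W) E' \<sigma>" "\<And>x. x \<in> W \<Longrightarrow> p' (\<sigma> x) = g' x"
    using W unfolding liftable_def by auto
  let ?S = "{x \<in> A. h x \<in> W}"
  have top_A: "topspace (subtopology X A) = A"
    using openin_subset[OF A] by auto
  have "openin (subtopology X A) ?S"
    using openin_continuous_map_preimage[OF h W'] unfolding top_A .
  then have "openin X ?S"
    using A by (rule openin_trans_full)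
  moreover have "continuous_map (subtopology X ?S) (subtopology X' W) h"
  proof -
    have "continuous_map (subtopology X ?S) X' h"
      using h by (rule continuous_map_from_subtopology_mono) blast
    then show ?thesis
      by (rule continuous_map_into_subtopology) auto
  qed
  then have "continuous_map (subtopology X ?S) E (k \<circ> (\<sigma> \<circ> h))"
    using \<sigma>(1) k by (intro continuous_map_compose)
  moreover have "\<forall>x\<in>?S. p ((k \<circ> (\<sigma> \<circ> h)) x) = g x"
    using \<sigma>(2) compat by auto
  ultimately show ?thesis
    unfolding liftable_def by blast
qed

lemma relative_sectional_number_pullback_le:
  assumes h: "continuous_map X X' h"
    and k: "continuous_map E' E k"
    and compat: "\<And>x e. \<lbrakk>x \<in> topspace X; p' e = g' (h x)\<rbrakk> \<Longrightarrow> p (k e) = g x"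
  shows "relative_sectional_number E X p g \<le> relative_sectional_number E' X' p' g'"
proof (cases "relative_sectional_number E' X' p' g' = \<infinity>")
  case False
  then obtain \<U> where \<U>: "\<U> \<in> liftable_covers E' X' p' g'"
    and card: "relative_sectional_number E' X' p' g' = enat (card \<U>)"
    by (rule relative_sectional_number_attained)
  let ?pre = "\<lambda>U. {x \<in> topspace X. h x \<in> U}"
  have "liftable E X p g (?pre U)" if "U \<in> \<U>" for U
  proof (rule liftable_pullback[OF openin_topspace _ k])
    show "continuous_map (subtopology X (topspace X)) X' h"
      using h by simp
    show "liftable E' X' p' g' U"
      using that \<U> by (simp add: liftable_covers_def)
  qed (rule compat)
  moreover have "\<Union>(?pre ` \<U>) = topspace X"
  proof -
    have "h x \<in> \<Union>\<U>" if "x \<in> topspace X" for x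
      using that continuous_map_image_subset_topspace[OF h] \<U>
      by (auto simp: liftable_covers_def)
    then show ?thesis by auto
  qed
  ultimately have "?pre ` \<U> \<in> liftable_covers E X p g"
    using \<U> by (auto simp: liftable_covers_def)
  then have "relative_sectional_number E X p g \<le> enat (card (?pre ` \<U>))"
    by (rule relative_sectional_number_le)
  \<comment> \<open>Distinct members may have equal preimages, so the cardinality can drop.\<close>
  also have "\<dots> \<le> enat (card \<U>)"
    using \<U> by (auto simp: liftable_covers_def card_image_le)
  finally show ?thesis
    using card by simp
qed simp

text \<open>
  The finiteness assumption matters because \<open>\<infinity> * 0 = 0\<close>: the second factor vanishes
  when \<open>W\<close> is empty.
\<close>

lemma relative_sectional_number_prod_le:
  assumes fin: "relative_sectional_number W X q r \<noteq> \<infinity>"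
    and compat: "\<And>z w x. q w = r x \<Longrightarrow> g' (z, w) = g (z, x)"
  shows "relative_sectional_number E (prod_topology Z X) p g
    \<le> relative_sectional_number W X q r * relative_sectional_number E (prod_topology Z W) p g'"
proof (cases "relative_sectional_number E (prod_topology Z W) p g' = \<infinity>")
  case True
  \<comment> \<open>The right side is \<open>\<infinity>\<close> unless its first factor is
    \<open>0\<close>; then \<open>X\<close> is empty and the left side vanishes too.\<close>
  show ?thesis
  proof (cases "topspace X = {}")
    case True
    then have "relative_sectional_number E (prod_topology Z X) p g = 0"
      by (simp add: relative_sectional_number_eq_0_iff)
    then show ?thesis by simp
  next
    case False
    then have "relative_sectional_number W X q r \<noteq> 0"
      by (simp add: relative_sectional_number_eq_0_iff)
    with True have eq:
      "relative_sectional_number W X q r * relative_sectional_number E (prod_topology Z W) p g' = \<infinity>"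
      unfolding imult_is_infinity by blast
    show ?thesis
      unfolding eq by simp
  qed
next
  case False
  then obtain \<U> where \<U>: "\<U> \<in> liftable_covers E (prod_topology Z W) p g'"
    and card_\<U>: "relative_sectional_number E (prod_topology Z W) p g' = enat (card \<U>)"
    by (rule relative_sectional_number_attained)
  obtain \<V> where \<V>: "\<V> \<in> liftable_covers W X q r"
    and card_\<V>: "relative_sectional_number W X q r = enat (card \<V>)"
    using fin by (rule relative_sectional_number_attained)
  have "\<forall>V\<in>\<V>. \<exists>t. continuous_map (subtopology X V) W t \<and> (\<forall>x\<in>V. q (t x) = r x)"
    using \<V> by (auto simp: liftable_covers_def liftable_def)
  then obtain t where t: "\<And>V. V \<in> \<V> \<Longrightarrow> continuous_map (subtopology X V) W (t V)"
    and q_t: "\<And>V x. \<lbrakk>V \<in> \<V>; x \<in> V\<rbrakk> \<Longrightarrow> q (t V x) = r x"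
    by metis
  have V: "openin X V" if "V \<in> \<V>" for V
    using that \<V> by (auto simp: liftable_covers_def liftable_def)
  let ?h = "\<lambda>V (z, x). (z, t V x)"
  \<comment> \<open>\<open>?S (V, U)\<close> is the preimage of \<open>U\<close> under the partial
    map \<open>?h V\<close>; pairs \<open>(V, U)\<close> index the new cover, whence the product of
    cardinalities.\<close>
  let ?S = "\<lambda>(V, U). {b \<in> topspace Z \<times> V. ?h V b \<in> U}"
  have h: "continuous_map (subtopology (prod_topology Z X) (topspace Z \<times> V))
      (prod_topology Z W) (?h V)" if "V \<in> \<V>" for V
  proof -
    have "continuous_map (prod_topology Z (subtopology X V)) (prod_topology Z W) (?h V)"
      using t[OF that] continuous_map_prod_top[of Z "subtopology X V" Z W "\<lambda>z. z" "t V"] by simp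
    then show ?thesis
      by (simp add: subtopology_Times)
  qed
  have "liftable E (prod_topology Z X) p g (?S (V, U))" if "V \<in> \<V>" "U \<in> \<U>" for V U
  proof -
    have "liftable E (prod_topology Z X) p g {b \<in> topspace Z \<times> V. ?h V b \<in> U}"
    proof (rule liftable_pullback[OF _ h[OF that(1)]])
      show "openin (prod_topology Z X) (topspace Z \<times> V)"
        using V[OF that(1)] by (simp add: openin_prod_Times_iff)
      show "continuous_map E E id"
        by simp
      show "liftable E (prod_topology Z W) p g' U"
        using \<U> that by (auto simp: liftable_covers_def)
      \<comment> \<open>Since \<open>q (t V x) = r x\<close>, \<open>compat\<close> gives
        \<open>g' (z, t V x) = g (z, x)\<close>.\<close>
      show "p (id e) = g b" if "b \<in> topspace Z \<times> V" "p e = g' (?h V b)" for b e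
        using that q_t[OF \<open>V \<in> \<V>\<close>] compat by auto
    qed
    then show ?thesis by simp
  qed
  moreover have "\<Union>(?S ` (\<V> \<times> \<U>)) = topspace (prod_topology Z X)"
  proof
    show "\<Union>(?S ` (\<V> \<times> \<U>)) \<subseteq> topspace (prod_topology Z X)"
      using V openin_subset by fastforce
    show "topspace (prod_topology Z X) \<subseteq> \<Union>(?S ` (\<V> \<times> \<U>))"
    proof clarify
      fix z x
      assume zx: "(z, x) \<in> topspace (prod_topology Z X)"
      then have "x \<in> \<Union>\<V>"
        using \<V> by (auto simp: liftable_covers_def)
      then obtain V where V: "V \<in> \<V>" "x \<in> V"
        by auto
      then have "t V x \<in> topspace W"
        using zx continuous_map_image_subset_topspace[OF t[OF V(1)]] by auto
      then have "(z, t V x) \<in> \<Union>\<U>"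
        using zx \<U> by (auto simp: liftable_covers_def)
      then obtain U where "U \<in> \<U>" "(z, t V x) \<in> U"
        by auto
      then show "(z, x) \<in> \<Union>(?S ` (\<V> \<times> \<U>))"
        using V zx by (intro UnionI[of "?S (V, U)"]) auto
    qed
  qed
  moreover have fin_prod: "finite (\<V> \<times> \<U>)"
    using \<U> \<V> by (auto simp: liftable_covers_def)
  ultimately have "?S ` (\<V> \<times> \<U>) \<in> liftable_covers E (prod_topology Z X) p g"
    by (auto simp: liftable_covers_def)
  then have "relative_sectional_number E (prod_topology Z X) p g \<le> enat (card (?S ` (\<V> \<times> \<U>)))"
    by (rule relative_sectional_number_le)
  also have "\<dots> \<le> enat (card (\<V> \<times> \<U>))"
    using fin_prod by (simp only: enat_ord_simps card_image_le)
  finally show ?thesis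
    by (simp add: card_\<U> card_\<V> card_cartesian_product)
qed

section \<open>Path evaluation and the individual inequalities\<close>

lemma continuous_map_path_eval:
  assumes "t \<in> {0..1}"
  shows "continuous_map (path_space Z) Z (\<lambda>\<gamma>. \<gamma> t)"
  unfolding continuous_map_def
proof (intro conjI allI impI)
  show "(\<lambda>\<gamma>. \<gamma> t) \<in> topspace (path_space Z) \<rightarrow> topspace Z"
    using assms
    by (auto simp: topspace_path_space paths_def pathin_def continuous_map_def)
  fix U assume "openin Z U"
  \<comment> \<open>The preimage of \<open>U\<close> under evaluation at \<open>t\<close> is the
    subbasic set of the compact set \<open>{t}\<close>.\<close>
  then have "{\<gamma> \<in> paths Z. \<gamma> ` {t} \<subseteq> U} \<in>
      {{\<gamma> \<in> paths Z. \<gamma> ` K \<subseteq> U} | K U. compact K \<and> K \<subseteq> {0..1} \<and> openin Z U}"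
    using assms by (intro CollectI exI[of _ "{t}"] exI[of _ U]) auto
  then have "openin (path_space Z) {\<gamma> \<in> paths Z. \<gamma> ` {t} \<subseteq> U}"
    unfolding path_space_def by (rule topology_generated_by_Basis)
  then show "openin (path_space Z) {\<gamma> \<in> topspace (path_space Z). \<gamma> t \<in> U}"
    by (simp add: topspace_path_space)
qed

lemma TC_map_eq_relative:
  "TC_map Z Y f = relative_sectional_number (path_space Z) (prod_topology Z Y) (endpoint_map f) id"
  unfolding TC_map_def sectional_number_eq_relative ..

lemma endpoint_map_apply: "endpoint_map f \<gamma> = (\<gamma> 0, f (\<gamma> 1))"
  by (simp add: endpoint_map_def endpoints_def)

lemma TC_relative_le_TC_map:
  assumes "continuous_map X Y g"
  shows "TC_relative Z X f g \<le> TC_map Z Y f"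
  unfolding TC_relative_def TC_map_eq_relative
proof (rule relative_sectional_number_pullback_le)
  show "continuous_map (prod_topology Z X) (prod_topology Z Y) (map_prod id g)"
    using assms continuous_map_prod_top[of Z X Z Y id g] by (simp add: map_prod_def)
  show "continuous_map (path_space Z) (path_space Z) id"
    by simp
qed simp

text \<open>A path from \<open>z\<close> to \<open>w\<close> has \<open>endpoint_map f\<close> equal
  to \<open>(z, f w)\<close>, so a local motion planner for \<open>Z\<close> is already the required
  lift.\<close>

lemma TC_relative_self_le_TC_space: "TC_relative Z Z f f \<le> TC_space Z"
  unfolding TC_relative_def TC_space_def TC_map_eq_relative
  by (rule relative_sectional_number_pullback_le[where h = id and k = id])
    (auto simp: endpoint_map_apply)

text \<open>On the slice through a fixed \<open>z\<close>, a lift assigns to \<open>x\<close> a path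
  \<open>\<gamma>\<close> with \<open>f (\<gamma> 1) = g x\<close>; its end point lifts
  \<open>g\<close> through \<open>f\<close>.\<close>

lemma relative_sectional_number_le_TC_relative:
  assumes "topspace Z = {} \<Longrightarrow> topspace X = {}"
  shows "relative_sectional_number Z X f g \<le> TC_relative Z X f g"
proof (cases "topspace Z = {}")
  case True
  with assms have "relative_sectional_number Z X f g = 0"
    by (simp add: relative_sectional_number_eq_0_iff)
  then show ?thesis by simp
next
  case False
  then obtain z where z: "z \<in> topspace Z"
    unfolding ex_in_conv[symmetric] ..
  show ?thesis
    unfolding TC_relative_def
  proof (rule relative_sectional_number_pullback_le)
    show "continuous_map X (prod_topology Z X) (\<lambda>x. (z, x))"
      using z by (simp add: continuous_map_pairwise o_def)
    show "continuous_map (path_space Z) Z (\<lambda>\<gamma>. \<gamma> 1)"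
      by (rule continuous_map_path_eval) simp
  qed (simp add: endpoint_map_apply)
qed

text \<open>Product bound for local sections \<open>s\<close> of \<open>g\<close>:
  \<open>map_prod id g\<close> sends \<open>(z, s y)\<close> back to \<open>(z, y)\<close>.\<close>

lemma TC_map_le_mult:
  assumes "sectional_number X Y g \<noteq> \<infinity>"
  shows "TC_map Z Y f \<le> sectional_number X Y g * TC_relative Z X f g"
  using assms unfolding TC_map_eq_relative sectional_number_eq_relative TC_relative_def
  by (rule relative_sectional_number_prod_le) simp

lemma TC_relative_le_mult:
  "TC_relative Z X f g \<le> relative_sectional_number Z X f g * TC_space Z"
proof (cases "relative_sectional_number Z X f g = \<infinity>")
  case True
  \<comment> \<open>The product bound requires a finite first factor. Here the right side is
    \<open>\<infinity>\<close> unless \<open>TC_space Z = 0\<close>; then \<open>Z\<close> is empty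
    and the left side is \<open>0\<close>.\<close>
  show ?thesis
  proof (cases "topspace Z = {}")
    case True
    then have "TC_relative Z X f g = 0"
      by (simp add: TC_relative_def relative_sectional_number_eq_0_iff)
    then show ?thesis by simp
  next
    case False
    then have "TC_space Z \<noteq> 0"
      by (simp add: TC_space_def TC_map_eq_relative relative_sectional_number_eq_0_iff)
    with \<open>relative_sectional_number Z X f g = \<infinity>\<close>
    have eq: "relative_sectional_number Z X f g * TC_space Z = \<infinity>"
      unfolding imult_is_infinity by blast
    show ?thesis
      unfolding eq by simp
  qed
next
  case False
  \<comment> \<open>The product bound with \<open>W = Z\<close>: if \<open>f (t x) = g x\<close>,
    then \<open>map_prod id f\<close> at \<open>(z, t x)\<close> agrees with
    \<open>map_prod id g\<close> at \<open>(z, x)\<close>.\<close>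
  then have "TC_relative Z X f g \<le> relative_sectional_number Z X f g * TC_relative Z Z f f"
    unfolding TC_relative_def by (rule relative_sectional_number_prod_le) simp
  also have "\<dots> \<le> relative_sectional_number Z X f g * TC_space Z"
    by (intro mult_left_mono TC_relative_self_le_TC_space) simp
  finally show ?thesis .
qed

section \<open>Extended quotients and assembly of the bounds\<close>

text \<open>In \<open>ennreal\<close>, \<open>a / \<infinity> = 0\<close> even for
  \<open>a = \<infinity>\<close>, so a product inequality for finite \<open>b\<close>
  suffices.\<close>

lemma ennreal_of_enat_divide_le:
  assumes "b \<noteq> \<infinity> \<Longrightarrow> a \<le> b * c"
  shows "ennreal_of_enat a / ennreal_of_enat b \<le> ennreal_of_enat c"
proof (cases b)
  case (enat n)
  show ?thesis
  proof (cases c)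
    case (enat m)
    with \<open>b = enat n\<close> assms obtain k where k: "a = enat k" "k \<le> n * m"
      by (cases a) auto
    show ?thesis
    proof (cases "n = 0")
      \<comment> \<open>Now \<open>a = 0\<close> as well, and \<open>0 / 0 = 0\<close>.\<close>
      case True
      with k show ?thesis by simp
    next
      case False
      have "ennreal_of_enat a \<le> ennreal_of_enat c * ennreal_of_enat b"
        using k \<open>b = enat n\<close> \<open>c = enat m\<close>
        by (simp add: mult.commute flip: of_nat_mult)
      then show ?thesis
        using False \<open>b = enat n\<close>
        by (intro divide_le_posI_ennreal) (simp_all add: mult.commute)
    qed
  qed simp
qed simp

theorem theorem4p3:
  fixes Z :: "'z topology" and Y :: "'y topology" and X :: "'x topology"
    and f :: "'z \<Rightarrow> 'y" and g :: "'x \<Rightarrow> 'y"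
  assumes "continuous_map Z Y f"
    and "continuous_map X Y g"
    and "topspace Z = {} \<Longrightarrow> topspace X = {}"
  shows "max (ennreal_of_enat (TC_map Z Y f) / ennreal_of_enat (sectional_number X Y g))
             (ennreal_of_enat (relative_sectional_number Z X f g))
           \<le> ennreal_of_enat (TC_relative Z X f g)
       \<and> TC_relative Z X f g
           \<le> min (TC_map Z Y f) (relative_sectional_number Z X f g * TC_space Z)"
proof (intro conjI max.boundedI min.boundedI)
  show "ennreal_of_enat (TC_map Z Y f) / ennreal_of_enat (sectional_number X Y g)
      \<le> ennreal_of_enat (TC_relative Z X f g)"
    by (intro ennreal_of_enat_divide_le TC_map_le_mult)
  \<comment> \<open>The third assumption excludes empty \<open>Z\<close> with nonempty
    \<open>X\<close>, where \<open>TC_relative Z X f g = 0\<close> but the relative sectional number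
    is positive.\<close>
  show "ennreal_of_enat (relative_sectional_number Z X f g)
      \<le> ennreal_of_enat (TC_relative Z X f g)"
    using relative_sectional_number_le_TC_relative[OF assms(3)] by simp
  show "TC_relative Z X f g \<le> TC_map Z Y f"
    using assms(2) by (rule TC_relative_le_TC_map)
  show "TC_relative Z X f g \<le> relative_sectional_number Z X f g * TC_space Z"
    by (rule TC_relative_le_mult)
qed

end
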